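(* Let $n \geq 1$, let $K$ be a field and let $T\colon M_n(K) \to M_n(K)$ be a linear map which strongly preserves either $\mathcal{L}$ or $\mathcal{R}$. Then $T$ is bijective.
   Context: $M_n(K)$ is the set of $n \times n$ matrices over $K$, viewed as a $K$-vector space and as a monoid under multiplication. Green's relations on $M_n(K)$: $A\,\mathcal{L}\,B$ if there exist $X, Y \in M_n(K)$ with $A = XB$ and $B = YA$; $A\,\mathcal{R}\,B$ if there exist $X, Y \in M_n(K)$ with $A = BX$ and $B = AY$. A map $T$ strongly preserves a binary relation $\equiv$ on $M_n(K)$ if, for all $A, B \in M_n(K)$, $A \equiv B$ if and only if $T(A) \equiv T(B)$. *)

theory Defs
  imports "HOL-Analysis.Analysis"
begin

text \<open>
  The set of square matrices of size n over K is the type \<open>'k ^ 'n ^ 'n\<close>, where \<open>'k\<close> has class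
  \<open>field\<close> and \<open>'n\<close> is a finite index type with n elements; types are nonempty, so n is at
  least 1. The library scaling \<open>*s\<close> on \<open>'k ^ 'n ^ 'n\<close> would take its scalars in \<open>'k ^ 'n\<close>,
  hence the separate definition of scaling by an element of \<open>'k\<close>.
\<close>

definition matrix_scale :: "'k::times \<Rightarrow> 'k ^ 'n ^ 'm \<Rightarrow> 'k ^ 'n ^ 'm" where
  "matrix_scale c A = (\<chi> i j. c * A $ i $ j)"

definition green_L :: "'k::semiring_1 ^ 'n ^ 'n \<Rightarrow> 'k ^ 'n ^ 'n \<Rightarrow> bool" where
  "green_L A B \<longleftrightarrow> (\<exists>X Y. A = X ** B \<and> B = Y ** A)"

definition green_R :: "'k::semiring_1 ^ 'n ^ 'n \<Rightarrow> 'k ^ 'n ^ 'n \<Rightarrow> bool" where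
  "green_R A B \<longleftrightarrow> (\<exists>X Y. A = B ** X \<and> B = A ** Y)"

definition strongly_preserves :: "('a \<Rightarrow> 'a) \<Rightarrow> ('a \<Rightarrow> 'a \<Rightarrow> bool) \<Rightarrow> bool" where
  "strongly_preserves T rel \<longleftrightarrow> (\<forall>A B. rel A B \<longleftrightarrow> rel (T A) (T B))"

text \<open>The locale predicate \<open>Vector_Spaces.linear\<close> includes the vector space axioms for the scaling;
  they hold here.\<close>

lemma vector_space_matrix_scale:
  "vector_space (matrix_scale :: 'k::field \<Rightarrow> 'k ^ 'n ^ 'm \<Rightarrow> 'k ^ 'n ^ 'm)"
  by unfold_locales (simp_all add: matrix_scale_def vec_eq_iff algebra_simps)

end

theory Submission
  imports Defs
begin

text \<open>A multiple of the zero matrix is zero, so 0 is alone in its class for both relations.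
  Since \<open>T 0 = 0\<close>, strong preservation pulls this back along \<open>T\<close>: only 0
  is sent to 0 (\<open>strongly_preserves_imp_inj\<close>). An injective linear endomorphism of a
  finite-dimensional space is surjective (\<open>linear_matrix_inj_imp_surj\<close>).\<close>

lemma green_L_zero_right_iff: "green_L A 0 \<longleftrightarrow> A = 0"
  by (auto simp: green_L_def)

lemma green_R_zero_right_iff: "green_R A 0 \<longleftrightarrow> A = 0"
  by (auto simp: green_R_def)

text \<open>The relation is kept abstract so that one kernel argument serves both Green
  relations.\<close>

lemma strongly_preserves_imp_inj:
  assumes "Vector_Spaces.linear s s T"
    and "strongly_preserves T rel"
    and rel_zero: "\<And>A. rel A 0 \<longleftrightarrow> A = 0"
  shows "inj T"
proof -
  interpret T: Vector_Spaces.linear s s T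
    by fact
  \<comment> \<open>Here \<open>rel (T A) (T 0)\<close> is \<open>rel 0 0\<close>, true by
    \<open>rel_zero\<close>; preservation read backwards gives \<open>rel A 0\<close>.\<close>
  have "A = 0" if "T A = 0" for A
    using assms(2) that rel_zero T.zero unfolding strongly_preserves_def by metis
  then show ?thesis
    using T.inj_iff_eq_0 by blast
qed

text \<open>Flattening a matrix to a vector indexed by pairs reduces this to the finite-dimensional
  space of coordinate vectors.\<close>

lemma linear_matrix_inj_imp_surj:
  fixes T :: "'k::field ^ 'n ^ 'm \<Rightarrow> 'k ^ 'n ^ 'm"
  assumes "Vector_Spaces.linear matrix_scale matrix_scale T"
    and "inj T"
  shows "surj T"
proof -
  interpret T: Vector_Spaces.linear matrix_scale matrix_scale T
    by fact
  define flat :: "'k ^ 'n ^ 'm \<Rightarrow> 'k ^ ('m \<times> 'n)"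
    where "flat A = (\<chi> p. A $ fst p $ snd p)" for A
  define unflat :: "'k ^ ('m \<times> 'n) \<Rightarrow> 'k ^ 'n ^ 'm"
    where "unflat v = (\<chi> i j. v $ (i, j))" for v
  have unflat_flat: "unflat (flat A) = A" for A
    by (simp add: flat_def unflat_def vec_eq_iff)
  have flat_unflat: "flat (unflat v) = v" for v
    by (simp add: flat_def unflat_def vec_eq_iff)
  have unflat_add: "unflat (v + w) = unflat v + unflat w" for v w
    by (simp add: unflat_def vec_eq_iff)
  have unflat_scale: "unflat (c *s v) = matrix_scale c (unflat v)" for c v
    by (simp add: unflat_def matrix_scale_def vec_eq_iff)
  have flat_add: "flat (A + B) = flat A + flat B" for A B
    by (simp add: flat_def vec_eq_iff)
  have flat_scale: "flat (matrix_scale c A) = c *s flat A" for c A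
    by (simp add: flat_def matrix_scale_def vec_eq_iff)
  have "Vector_Spaces.linear (*s) (*s) (\<lambda>v. flat (T (unflat v)))"
    unfolding Vector_Spaces.linear_iff
    by (simp add: vec.vector_space_axioms unflat_add unflat_scale flat_add flat_scale T.add T.scale)
  moreover have "inj (\<lambda>v. flat (T (unflat v)))"
    by (metis (mono_tags, lifting) assms(2) flat_unflat injD injI unflat_flat)
  ultimately have "surj (\<lambda>v. flat (T (unflat v)))"
    by (rule vec.linear_inj_imp_surj)
  \<comment> \<open>If \<open>v\<close> is sent to \<open>flat A\<close> by the conjugated map, then
    \<open>T\<close> sends \<open>unflat v\<close> to \<open>A\<close>.\<close>
  then show ?thesis
    unfolding surj_def by (metis unflat_flat)
qed

theorem proposition3p5:
  fixes T :: "'k::field ^ 'n ^ 'n \<Rightarrow> 'k ^ 'n ^ 'n"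
  assumes "Vector_Spaces.linear matrix_scale matrix_scale T"
    and "strongly_preserves T green_L \<or> strongly_preserves T green_R"
  shows "bij T"
proof -
  have "inj T"
    using assms(2) strongly_preserves_imp_inj[OF assms(1)]
      green_L_zero_right_iff green_R_zero_right_iff by blast
  then show ?thesis
    using linear_matrix_inj_imp_surj[OF assms(1)] by (simp add: bij_def)
qed

end
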